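(* Let $\mathfrak g_f=\mathfrak h\oplus\mathfrak m$ and the generators $b(\delta\boldsymbol v)$, $a(\delta C)$ be as in the context. The decomposition is reductive, $[\mathfrak h,\mathfrak m]\subseteq\mathfrak m$, and the generators $b(\delta\boldsymbol v)$, $a(\delta C)$ lie in $\mathfrak m$ with brackets $$[b(\delta\boldsymbol v_1),b(\delta\boldsymbol v_2)]=0,\qquad [b(\delta\boldsymbol v),a(\delta C)]=b\Bigl(-\frac{\delta C\,\delta\boldsymbol v}{2c^2}\Bigr)\in\mathfrak m,$$ $$[a(\delta C_1),a(\delta C_2)]=\begin{pmatrix}0&0\\0&\dfrac{[\delta C_1,\delta C_2]}{4c^4}\end{pmatrix}\in\mathfrak h .$$ Consequently the canonical connection associated with the rotation-free section (curvature $-[X,Y]_{\mathfrak h}$ and torsion $-[X,Y]_{\mathfrak m}$ at the base point) has rotational curvature identically zero on boost--boost and boost--anisotropy planes, and on anisotropy--anisotropy planes equal to the commutator $[\delta C_1,\delta C_2]/(4c^4)$, nonzero exactly when the two sound-speed-tensor increments $\delta C_1,\delta C_2$ fail to commute (e.g. a normal stretch and a $45^\circ$ shear). The connection carries torsion on mixed boost--anisotropy planes, by the second bracket.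
   Context: Fix $c>0$ and $d\in\{2,3\}$. $G_f$ is the group of invertible real $(1+d)\times(1+d)$ matrices of block form $\begin{pmatrix}p&\boldsymbol q^{\mathrm T}\\0&S\end{pmatrix}$ with $p\ne0$, $S$ invertible $d\times d$; its Lie algebra is $\mathfrak g_f=\bigl\{\begin{pmatrix}\alpha&\boldsymbol\beta^{\mathrm T}\\0&\Sigma\end{pmatrix}:\alpha\in\mathbb R,\boldsymbol\beta\in\mathbb R^d,\Sigma\in\mathbb R^{d\times d}\bigr\}$. Let $\mathfrak h=\bigl\{\begin{pmatrix}0&0\\0&\Omega\end{pmatrix}:\Omega^{\mathrm T}=-\Omega\bigr\}\cong\mathfrak{so}(d)$ (spatial rotations, the Lie algebra of the stabiliser in $G_f$ of $Q_*=\operatorname{diag}(1,-c^2I)$ under $Q\mapsto MQM^{\mathrm T}$) and $\mathfrak m=\bigl\{\begin{pmatrix}\alpha&\boldsymbol\beta^{\mathrm T}\\0&\Sigma\end{pmatrix}:\Sigma=\Sigma^{\mathrm T}\bigr\}$ (the tangent space of the rotation-free section, i.e. of the matrices in $G_f$ with $p>0$ and $S$ symmetric positive definite). For $Z\in\mathfrak g_f$, $Z_{\mathfrak h}$ and $Z_{\mathfrak m}$ denote its components in $\mathfrak h$ and $\mathfrak m$. Boost generator: $b(\delta\boldsymbol v)=\begin{pmatrix}0&\delta\boldsymbol v^{\mathrm T}/c^2\\0&0\end{pmatrix}$ for $\delta\boldsymbol v\in\mathbb R^d$. Anisotropy generator: $a(\delta C)=\begin{pmatrix}0&0\\0&-\delta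 C/(2c^2)\end{pmatrix}$ for $\delta C$ a symmetric $d\times d$ matrix. (They are the derivatives at $\varepsilon=0$ of the canonical maps reducing to the d'Alembertian the wave operators of, respectively, the uniform-flow medium with velocity $\varepsilon\,\delta\boldsymbol v$ and the medium at rest with sound-speed tensor $c^2I+\varepsilon\,\delta C$.) In the claim, $\delta\boldsymbol v,\delta\boldsymbol v_1,\delta\boldsymbol v_2\in\mathbb R^d$ and $\delta C,\delta C_1,\delta C_2$ symmetric are arbitrary. Boost--boost, boost--anisotropy and anisotropy--anisotropy planes are those spanned by two $b$'s, by a $b$ and an $a$, and by two $a$'s. The canonical connection is that of the reductive homogeneous space with the decomposition $\mathfrak h\oplus\mathfrak m$; at the base point its curvature is $-[X,Y]_{\mathfrak h}$ and its torsion $-[X,Y]_{\mathfrak m}$ for $X,Y\in\mathfrak m$.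
   Formalization: With curvature −[X,Y]_h, the value on the ordered pair (a(δC1), a(δC2)) is −[δC1,δC2]/(4c⁴), not +; the stated value with plus sign holds for the opposite order (a(δC2), a(δC1)). Both oriented values are proved. *)

theory Defs
  imports "HOL-Analysis.Analysis"
begin

text \<open>
  Matrices of size \<open>1 + d\<close> with \<open>d = CARD('n)\<close>: the index \<open>None\<close> is time,
  \<open>Some i\<close> is the spatial index \<open>i\<close>.
\<close>

type_synonym 'n smat = "real^'n^'n"
type_synonym 'n stmat = "real^('n option)^('n option)"

definition block :: "real \<Rightarrow> real^'n \<Rightarrow> 'n::finite smat \<Rightarrow> 'n stmat" where
  "block p q S = (\<chi> i j. case i of
      None \<Rightarrow> (case j of None \<Rightarrow> p | Some l \<Rightarrow> q $ l)
    | Some k \<Rightarrow> (case j of None \<Rightarrow> 0 | Some l \<Rightarrow> S $ k $ l))"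

definition lie :: "real^'m::finite^'m \<Rightarrow> real^'m^'m \<Rightarrow> real^'m^'m" where
  "lie X Y = X ** Y - Y ** X"

definition g_alg :: "'n::finite stmat set" where
  "g_alg = {block \<alpha> \<beta> S | \<alpha> \<beta> S. True}"

definition h_alg :: "'n::finite stmat set" where
  "h_alg = {block 0 0 W | W. transpose W = - W}"

definition m_space :: "'n::finite stmat set" where
  "m_space = {block \<alpha> \<beta> S | \<alpha> \<beta> S. transpose S = S}"

definition h_comp :: "'n::finite stmat \<Rightarrow> 'n stmat" where
  "h_comp Z = (THE A. A \<in> h_alg \<and> Z - A \<in> m_space)"

definition m_comp :: "'n::finite stmat \<Rightarrow> 'n stmat" where
  "m_comp Z = (THE B. B \<in> m_space \<and> Z - B \<in> h_alg)"

definition boost :: "real \<Rightarrow> real^'n::finite \<Rightarrow> 'n stmat" where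
  "boost c v = block 0 ((1 / c^2) *\<^sub>R v) 0"

definition aniso :: "real \<Rightarrow> 'n::finite smat \<Rightarrow> 'n stmat" where
  "aniso c C = block 0 0 (- (1 / (2 * c^2)) *\<^sub>R C)"

text \<open>
  The canonical connection on the principal bundle \<open>G \<rightarrow> G/H\<close>.  The group \<open>G\<close> of invertible
  block upper triangular matrices is open in the linear space \<^const>\<open>g_alg\<close>, so a tangent vector
  of \<open>G\<close> is an element of \<^const>\<open>g_alg\<close>, and forms on \<open>G\<close> are functions of a point and of tangent
  vectors.  The left Maurer-Cartan form \<open>g\<^sup>-\<^sup>1 dg\<close> splits into its \<open>\<hh>\<close>-part, which is the connection
  form, and its \<open>\<mm>\<close>-part, which is the solder form.  Curvature and torsion are given by the
  structure equations \<open>\<Omega> = d\<omega> + \<omega> \<and> \<omega>\<close> and \<open>\<Theta> = d\<theta> + \<omega> \<and> \<theta>\<close>; the constant vector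
  fields \<open>V\<close>, \<open>W\<close> used in the exterior derivative commute.  At the identity, which lies over the
  base point of \<open>G/H\<close>, the horizontal space is \<^const>\<open>m_space\<close>.
\<close>

definition maurer_cartan :: "'n::finite stmat \<Rightarrow> 'n stmat \<Rightarrow> 'n stmat" where
  "maurer_cartan g V = matrix_inv g ** V"

definition conn_form :: "'n::finite stmat \<Rightarrow> 'n stmat \<Rightarrow> 'n stmat" where
  "conn_form g V = h_comp (maurer_cartan g V)"

definition solder_form :: "'n::finite stmat \<Rightarrow> 'n stmat \<Rightarrow> 'n stmat" where
  "solder_form g V = m_comp (maurer_cartan g V)"

definition ext_deriv ::
  "('n::finite stmat \<Rightarrow> 'n stmat \<Rightarrow> 'n stmat) \<Rightarrow> 'n stmat \<Rightarrow> 'n stmat \<Rightarrow> 'n stmat \<Rightarrow> 'n stmat" where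
  "ext_deriv \<eta> g V W =
     vector_derivative (\<lambda>t. \<eta> (g + t *\<^sub>R V) W) (at 0)
   - vector_derivative (\<lambda>t. \<eta> (g + t *\<^sub>R W) V) (at 0)"

definition curvature_form :: "'n::finite stmat \<Rightarrow> 'n stmat \<Rightarrow> 'n stmat \<Rightarrow> 'n stmat" where
  "curvature_form g V W = ext_deriv conn_form g V W + lie (conn_form g V) (conn_form g W)"

definition torsion_form :: "'n::finite stmat \<Rightarrow> 'n stmat \<Rightarrow> 'n stmat \<Rightarrow> 'n stmat" where
  "torsion_form g V W = ext_deriv solder_form g V W
     + lie (conn_form g V) (solder_form g W) - lie (conn_form g W) (solder_form g V)"

abbreviation curv0 :: "'n::finite stmat \<Rightarrow> 'n stmat \<Rightarrow> 'n stmat" where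
  "curv0 \<equiv> curvature_form (mat 1)"

abbreviation tors0 :: "'n::finite stmat \<Rightarrow> 'n stmat \<Rightarrow> 'n stmat" where
  "tors0 \<equiv> torsion_form (mat 1)"

definition normal_stretch :: "real^'n::finite \<Rightarrow> 'n smat" where
  "normal_stretch r = (\<chi> k l. if k = l then r $ k else 0)"

text \<open>The principal axes of this shear are at 45 degrees to the coordinate axes \<open>i\<close> and \<open>j\<close>.\<close>

definition shear45 :: "'n::finite \<Rightarrow> 'n \<Rightarrow> real \<Rightarrow> 'n smat" where
  "shear45 i j s = (\<chi> k l. if (k = i \<and> l = j) \<or> (k = j \<and> l = i) then s else 0)"

end

theory Submission
  imports Defs
begin

text \<open>
  The derivative of \<open>g\<^sup>-\<^sup>1\<close> at the identity in the direction \<open>V\<close> is \<open>-V\<close>, so the exterior derivative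
  there of the Maurer-Cartan form is \<open>-[V, W]\<close>, and applying the linear projections onto \<open>\<hh>\<close>
  and \<open>\<mm>\<close> gives \<open>-[V, W]\<close> projected.  For \<open>V, W \<in> \<mm>\<close> the connection form vanishes, hence so do
  the quadratic terms of the structure equations.  Everything else is a block matrix computation.
\<close>

section \<open>Differentiating the matrix inverse\<close>

text \<open>In finite dimension bilinearity implies boundedness. This yields both the algebraic
  rules of \<open>matrix_mult_bilinear\<close> and the norm constant for the derivative
  estimate.\<close>

lemma bounded_bilinear_matrix_mult:
  "bounded_bilinear ((**) :: real^'k^'m \<Rightarrow> real^'n^'k \<Rightarrow> real^'n^'m)"
  unfolding bilinear_conv_bounded_bilinear[symmetric] bilinear_def
  by (auto intro!: linearI simp: matrix_matrix_mult_def vec_eq_iff sum.distrib sum_distrib_left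
      algebra_simps)

lemmas matrix_mult_bilinear =
  bounded_bilinear.diff_left[OF bounded_bilinear_matrix_mult]
  bounded_bilinear.diff_right[OF bounded_bilinear_matrix_mult]
  bounded_bilinear.add_left[OF bounded_bilinear_matrix_mult]
  bounded_bilinear.add_right[OF bounded_bilinear_matrix_mult]
  bounded_bilinear.scaleR_left[OF bounded_bilinear_matrix_mult]
  bounded_bilinear.scaleR_right[OF bounded_bilinear_matrix_mult]
  bounded_bilinear.minus_left[OF bounded_bilinear_matrix_mult]
  bounded_bilinear.minus_right[OF bounded_bilinear_matrix_mult]
  bounded_bilinear.zero_left[OF bounded_bilinear_matrix_mult]
  bounded_bilinear.zero_right[OF bounded_bilinear_matrix_mult]

lemma invertible_matrix_inv:
  fixes A :: "real^'m^'m"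
  assumes "invertible A"
  shows "A ** matrix_inv A = mat 1" "matrix_inv A ** A = mat 1"
proof -
  have "A ** matrix_inv A = mat 1 \<and> matrix_inv A ** A = mat 1"
    using assms unfolding matrix_inv_def invertible_def by (rule someI_ex)
  then show "A ** matrix_inv A = mat 1" "matrix_inv A ** A = mat 1" by auto
qed

lemma matrix_inv_mat_1: "matrix_inv (mat 1 :: real^'m^'m) = mat 1"
  using invertible_matrix_inv(1)[of "mat 1 :: real^'m^'m"]
  by (simp add: invertible_def exI[of _ "mat 1"])

text \<open>A kernel vector x satisfies norm x = |t| norm (V x) \<le> |t| K norm x, which forces x =
  0 once |t| < 1 / K; an injective square matrix is invertible.\<close>

lemma eventually_invertible_mat_1_add:
  fixes V :: "real^'m^'m"
  shows "eventually (\<lambda>t. invertible (mat 1 + t *\<^sub>R V)) (nhds 0)"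
proof -
  obtain K where K: "K > 0" "\<And>x. norm (V *v x) \<le> norm x * K"
    using bounded_linear.pos_bounded[OF matrix_vector_mul_bounded_linear[of V]] by blast
  have "invertible (mat 1 + t *\<^sub>R V)" if t: "dist t 0 < 1 / K" for t
  proof -
    have "x = 0" if "(mat 1 + t *\<^sub>R V) *v x = 0" for x
    proof (rule ccontr)
      assume "x \<noteq> 0"
      have "x + t *\<^sub>R (V *v x) = 0"
        using that by (simp add: matrix_vector_mult_add_rdistrib scaleR_matrix_vector_assoc)
      then have "norm x = \<bar>t\<bar> * norm (V *v x)"
        by (metis add_eq_0_iff norm_minus_cancel norm_scaleR real_norm_def)
      also have "\<dots> \<le> \<bar>t\<bar> * (norm x * K)"
        using K(2) by (intro mult_left_mono) auto
      also have "\<dots> < norm x"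
        using t \<open>x \<noteq> 0\<close> K(1) by (simp add: field_simps)
      finally show False by simp
    qed
    then show ?thesis
      using invertible_left_inverse matrix_left_invertible_ker by blast
  qed
  then show ?thesis
    unfolding eventually_nhds_metric using K(1) by (intro exI[of _ "1 / K"]) auto
qed

text \<open>The inverse R satisfies R t = 1 - t (R t) V near 0. Inserting this identity into itself
  gives R t - 1 + t V = t^2 (R t) V V, which is quadratically small because R stays bounded near
  0.\<close>

lemma matrix_inv_has_vector_derivative:
  fixes V :: "real^'m^'m"
  shows "((\<lambda>t. matrix_inv (mat 1 + t *\<^sub>R V)) has_vector_derivative - V) (at 0)"
proof -
  define R where "R t = matrix_inv (mat 1 + t *\<^sub>R V)" for t
  obtain K where K: "0 < K
      \<and> (\<forall>(A :: real^'m^'m) (B :: real^'m^'m). norm (A ** B) \<le> norm A * norm B * K)"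
    using bounded_bilinear.pos_bounded[OF bounded_bilinear_matrix_mult] ..
  \<comment> \<open>The summand 1 keeps L positive even for V = 0, so that the radius 1 / (2 L)
    below is positive.\<close>
  define L where "L = norm V * K + 1"
  have L: "L > 0" using K by (simp add: L_def add_nonneg_pos)
  have nV: "norm (A ** V) \<le> norm A * L" for A :: "real^'m^'m"
    using K[THEN conjunct2, rule_format, of A V]
    by (simp add: L_def algebra_simps add_increasing)
  have R: "R t = mat 1 - t *\<^sub>R (R t ** V)" if "invertible (mat 1 + t *\<^sub>R V)" for t
  proof -
    have "R t + t *\<^sub>R (R t ** V) = mat 1"
      using invertible_matrix_inv(2)[OF that] unfolding R_def[symmetric]
      by (simp only: matrix_mult_bilinear matrix_mul_rid)
    then show ?thesis by (metis add_diff_cancel_right')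
  qed
  define N where "N = norm (mat 1 :: real^'m^'m)"
  have ev: "eventually (\<lambda>t. norm (R t - R 0 - t *\<^sub>R (- V)) \<le> 2 * N * L\<^sup>2 * t\<^sup>2) (nhds 0)"
  proof -
    \<comment> \<open>Within this radius |t| L \<le> 1/2, so the term with \<open>R t\<close> on the
      right of the norm estimate is at most half the left side and can be absorbed.\<close>
    have "eventually (\<lambda>t::real. dist t 0 < 1 / (2 * L)) (nhds 0)"
      unfolding eventually_nhds_metric using L by (intro exI[of _ "1 / (2 * L)"]) auto
    with eventually_invertible_mat_1_add[of V] show ?thesis
    proof eventually_elim
      case (elim t)
      note Rt = R[OF elim(1)]
      have tL: "\<bar>t\<bar> * L \<le> 1 / 2" using elim(2) L by (simp add: field_simps)
      have "norm (R t) \<le> N + norm (t *\<^sub>R (R t ** V))"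
        unfolding N_def by (subst Rt) (rule norm_triangle_ineq4)
      also have "\<dots> \<le> N + \<bar>t\<bar> * (norm (R t) * L)"
        using mult_left_mono[OF nV[of "R t"], of "\<bar>t\<bar>"] by simp
      also have "\<dots> \<le> N + norm (R t) * (1/2)"
        using mult_left_mono[OF tL, of "norm (R t)"] by (simp add: mult_ac)
      finally have bound: "norm (R t) \<le> 2 * N" by simp
      have "R 0 = mat 1" by (simp add: R_def matrix_inv_mat_1)
      \<comment> \<open>The identity \<open>Rt\<close> is inserted into itself to expose the
        second-order term.\<close>
      have "R t = mat 1 - t *\<^sub>R ((mat 1 - t *\<^sub>R (R t ** V)) ** V)"
        by (subst Rt[symmetric]) (rule Rt)
      then have "R t - R 0 - t *\<^sub>R (- V)
          = mat 1 - t *\<^sub>R ((mat 1 - t *\<^sub>R (R t ** V)) ** V) - mat 1 - t *\<^sub>R (- V)"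
        unfolding \<open>R 0 = mat 1\<close> by (rule arg_cong)
      also have "\<dots> = t\<^sup>2 *\<^sub>R (R t ** V ** V)"
        by (simp add: matrix_mult_bilinear scaleR_diff_right power2_eq_square)
      finally have "norm (R t - R 0 - t *\<^sub>R (- V)) = t\<^sup>2 * norm (R t ** V ** V)"
        by (simp only: norm_scaleR) simp
      also have "\<dots> \<le> t\<^sup>2 * (norm (R t) * L * L)"
        using order_trans[OF nV mult_right_mono[OF nV]] L by (intro mult_left_mono) auto
      also have "\<dots> \<le> t\<^sup>2 * (2 * N * L * L)"
        using bound L by (intro mult_left_mono mult_right_mono) auto
      finally show ?case by (simp add: power2_eq_square mult_ac)
    qed
  qed
  have "(R has_vector_derivative - V) (at 0)"
    unfolding has_vector_derivative_def has_derivative_at2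
  proof (intro conjI)
    show "bounded_linear (\<lambda>x. x *\<^sub>R - V)" by (rule bounded_linear_scaleR_left)
    have "eventually (\<lambda>t. norm ((1 / norm (t - 0)) *\<^sub>R (R t - (R 0 + (t - 0) *\<^sub>R (- V))))
        \<le> 2 * N * L\<^sup>2 * \<bar>t\<bar>) (at 0)"
      using ev unfolding eventually_at_filter
    proof eventually_elim
      case (elim t)
      show ?case
      proof (intro impI)
        assume "t \<noteq> 0"
        have "norm (R t - R 0 - t *\<^sub>R (- V)) \<le> 2 * N * L\<^sup>2 * \<bar>t\<bar> * \<bar>t\<bar>"
          using elim by (simp add: power2_eq_square mult.assoc)
        then show "norm ((1 / norm (t - 0)) *\<^sub>R (R t - (R 0 + (t - 0) *\<^sub>R (- V))))
            \<le> 2 * N * L\<^sup>2 * \<bar>t\<bar>"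
          using \<open>t \<noteq> 0\<close> by (simp add: pos_divide_le_eq diff_diff_eq2 diff_add_eq)
      qed
    qed
    moreover have "((\<lambda>t::real. 2 * N * L\<^sup>2 * \<bar>t\<bar>) \<longlongrightarrow> 0) (at 0)"
      by (auto intro!: tendsto_eq_intros)
    ultimately show "(\<lambda>t. (1 / norm (t - 0)) *\<^sub>R (R t - (R 0 + (t - 0) *\<^sub>R (- V)))) \<midarrow>0\<rightarrow> 0"
      by (rule Lim_null_comparison)
  qed
  then show ?thesis unfolding R_def .
qed

section \<open>Block calculus\<close>

lemma block_nth [simp]:
  "block p q S $ None $ None = p"
  "block p q S $ None $ Some l = q $ l"
  "block p q S $ Some k $ None = 0"
  "block p q S $ Some k $ Some l = S $ k $ l"
  by (simp_all add: block_def)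

lemma stmat_eq_iff:
  fixes A B :: "'n::finite stmat"
  shows "A = B \<longleftrightarrow> A $ None $ None = B $ None $ None \<and> (\<forall>l. A $ None $ Some l = B $ None $ Some l)
    \<and> (\<forall>k. A $ Some k $ None = B $ Some k $ None)
    \<and> (\<forall>k l. A $ Some k $ Some l = B $ Some k $ Some l)"
  by (simp add: vec_eq_iff split_option_all) blast

lemma block_eq_iff [simp]: "block p q S = block p' q' S' \<longleftrightarrow> p = p' \<and> q = q' \<and> S = S'"
  by (auto simp: stmat_eq_iff vec_eq_iff)

lemma block_zero: "0 = block 0 0 0"
  and block_add: "block p q S + block p' q' S' = block (p + p') (q + q') (S + S')"
  and block_diff: "block p q S - block p' q' S' = block (p - p') (q - q') (S - S')"
  and block_uminus: "- block p q S = block (- p) (- q) (- S)"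
  and block_scaleR: "r *\<^sub>R block p q S = block (r * p) (r *\<^sub>R q) (r *\<^sub>R S)"
  by (auto simp: stmat_eq_iff)

lemmas block_linear = block_add block_diff block_uminus block_scaleR

lemma sum_UNIV_option: "(\<Sum>k\<in>UNIV. f k) = f None + (\<Sum>k\<in>UNIV. f (Some k))"
  for f :: "'n::finite option \<Rightarrow> real"
  by (simp add: UNIV_option_conv sum.reindex)

lemma block_mult:
  "block p q S ** block p' q' S' = block (p * p') (p *\<^sub>R q' + q v* S') (S ** S')"
  by (simp add: stmat_eq_iff matrix_matrix_mult_def vector_matrix_mult_def sum_UNIV_option mult.commute)

text \<open>The time-time corners are scalars and commute, so they cancel; the spatial blocks
  multiply without interference from the top row.\<close>

lemma lie_block:
  "lie (block p q S) (block p' q' S') =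
    block 0 (p *\<^sub>R q' + q v* S' - (p' *\<^sub>R q + q' v* S)) (lie S S')"
  by (simp add: lie_def block_mult block_linear)

section \<open>Transposes and brackets of square matrices\<close>

lemma transpose_linear:
  fixes A B :: "real^'n^'n"
  shows "transpose (A + B) = transpose A + transpose B"
    "transpose (A - B) = transpose A - transpose B"
    "transpose (- A) = - transpose A"
    "transpose (r *\<^sub>R A) = r *\<^sub>R transpose A"
    "transpose (0 :: real^'n^'n) = 0"
  by (simp_all add: vec_eq_iff transpose_def)

lemma transpose_lie: "transpose (lie A B) = lie (transpose B) (transpose A)"
  for A B :: "real^'n^'n"
  by (simp add: lie_def transpose_linear matrix_transpose_mul)

lemma lie_uminus_right: "lie A (- B) = - lie A B"
  for A B :: "real^'n^'n"
  by (simp add: lie_def matrix_mult_bilinear)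

lemma lie_scaleR: "lie (a *\<^sub>R A) (b *\<^sub>R B) = (a * b) *\<^sub>R lie A B"
  for A B :: "real^'n^'n"
  by (simp add: lie_def matrix_mult_bilinear algebra_simps)

lemma lie_anticommute: "lie A B = - lie B A"
  by (simp add: lie_def)

text \<open>The bracket is bilinear and alternating, so on a plane it is the bracket of the
  generators times the determinant of the coordinates. This reduces statements about planes to a
  single bracket.\<close>

lemma lie_span_pair:
  fixes A B :: "real^'n^'n"
  assumes "X \<in> span {A, B}" "Y \<in> span {A, B}"
  obtains k where "lie X Y = k *\<^sub>R lie A B"
proof -
  obtain a b where X: "X = a *\<^sub>R A + b *\<^sub>R B"
    using assms(1) by (auto simp: span_breakdown_eq algebra_simps)
  obtain a' b' where Y: "Y = a' *\<^sub>R A + b' *\<^sub>R B"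
    using assms(2) by (auto simp: span_breakdown_eq algebra_simps)
  have "lie X Y = (a * b' - b * a') *\<^sub>R lie A B"
    by (simp add: lie_def X Y matrix_mult_bilinear algebra_simps)
  then show ?thesis by (rule that)
qed

section \<open>The reductive decomposition\<close>

lemma block_in_g_alg [simp]: "block p q S \<in> g_alg"
  by (auto simp: g_alg_def)

text \<open>Membership becomes a set of linear equations on entries, from which the subspace
  property and closure under inverses can be read off.\<close>

lemma g_alg_iff: "Z \<in> g_alg \<longleftrightarrow> (\<forall>k. Z $ Some k $ None = 0)"
proof
  assume "\<forall>k. Z $ Some k $ None = 0"
  then have "Z = block (Z $ None $ None) (\<chi> l. Z $ None $ Some l) (\<chi> k l. Z $ Some k $ Some l)"
    by (simp add: stmat_eq_iff)
  then show "Z \<in> g_alg" by (metis block_in_g_alg)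
qed (auto simp: g_alg_def)

lemma block_in_h_alg [simp]: "block p q S \<in> h_alg \<longleftrightarrow> p = 0 \<and> q = 0 \<and> transpose S = - S"
  by (auto simp: h_alg_def)

lemma block_in_m_space [simp]: "block p q S \<in> m_space \<longleftrightarrow> transpose S = S"
  by (auto simp: m_space_def)

lemma m_space_subset_g_alg: "m_space \<subseteq> g_alg"
  by (auto simp: m_space_def)

lemma subspace_g_alg: "subspace g_alg"
  by (auto simp: subspace_def g_alg_iff)

lemma subspace_h_alg: "subspace h_alg"
proof (rule subspaceI)
  show "0 \<in> h_alg" by (simp add: block_zero transpose_linear)
qed (auto simp: h_alg_def block_linear transpose_linear)

lemma subspace_m_space: "subspace m_space"
proof (rule subspaceI)
  show "0 \<in> m_space" by (simp add: block_zero transpose_linear)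
qed (auto simp: m_space_def block_linear transpose_linear)

text \<open>A spatial block that is both symmetric and antisymmetric vanishes. This is what makes
  the two components of a matrix unique.\<close>

lemma h_alg_inter_m_space: "h_alg \<inter> m_space = {0}"
proof -
  have "Z = 0" if "Z \<in> h_alg" "Z \<in> m_space" for Z :: "'n::finite stmat"
  proof -
    obtain W where Z: "Z = block 0 0 W" "transpose W = - W"
      using \<open>Z \<in> h_alg\<close> by (auto simp: h_alg_def)
    then have "- W = W" using \<open>Z \<in> m_space\<close> by simp
    then have "W = 0" by (simp add: vec_eq_iff)
    with Z show ?thesis by (simp add: block_zero)
  qed
  then show ?thesis
    using subspace_0[OF subspace_h_alg] subspace_0[OF subspace_m_space] by blast
qed

lemma g_alg_eq_sum: "g_alg = {A + B | A B. A \<in> h_alg \<and> B \<in> m_space}"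
proof (intro set_eqI iffI)
  fix Z :: "'n::finite stmat" assume "Z \<in> g_alg"
  then obtain p q S where Z: "Z = block p q S" by (auto simp: g_alg_def)
  \<comment> \<open>The spatial block is split into its antisymmetric and symmetric halves; the
    whole top row goes to \<open>m_space\<close>.\<close>
  have "Z = block 0 0 ((1/2) *\<^sub>R (S - transpose S)) + block p q ((1/2) *\<^sub>R (S + transpose S))"
    by (simp add: Z block_linear algebra_simps flip: scaleR_add_left)
  moreover have "block 0 0 ((1/2) *\<^sub>R (S - transpose S)) \<in> h_alg"
    "block p q ((1/2) *\<^sub>R (S + transpose S)) \<in> m_space"
    by (simp_all add: transpose_linear algebra_simps)
  ultimately show "Z \<in> {A + B | A B. A \<in> h_alg \<and> B \<in> m_space}" by blast
qed (auto simp: h_alg_def m_space_def block_linear)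

text \<open>Transposition reverses a bracket, and the antisymmetric factor contributes another sign;
  the two signs cancel, so the spatial block of the bracket is symmetric.\<close>

lemma lie_h_alg_m_space:
  assumes "A \<in> h_alg" "B \<in> m_space"
  shows "lie A B \<in> m_space"
proof -
  obtain W where A: "A = block 0 0 W" "transpose W = - W" using assms(1) by (auto simp: h_alg_def)
  obtain p q S where B: "B = block p q S" "transpose S = S" using assms(2) by (auto simp: m_space_def)
  have "transpose (lie W S) = - lie S W"
    by (simp add: transpose_lie A B lie_uminus_right)
  also have "\<dots> = lie W S" by (rule lie_anticommute[symmetric])
  finally show ?thesis by (simp add: A B lie_block)
qed

text \<open>Two candidates differ by an element of \<open>h_alg\<close> that also lies in
  \<open>m_space\<close>, hence by 0. Exhibiting one candidate therefore evaluates the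
  description.\<close>

lemma h_comp_unique:
  assumes "A \<in> h_alg" "Z - A \<in> m_space"
  shows "h_comp Z = A"
  unfolding h_comp_def
proof (rule the_equality)
  fix A' assume A': "A' \<in> h_alg \<and> Z - A' \<in> m_space"
  have "A' - A \<in> h_alg" using A' assms subspace_diff[OF subspace_h_alg] by blast
  moreover have "A' - A \<in> m_space"
    using subspace_diff[OF subspace_m_space, of "Z - A" "Z - A'"] A' assms by simp
  ultimately have "A' - A \<in> {0}" using h_alg_inter_m_space by blast
  then show "A' = A" by simp
qed (use assms in simp)

lemma m_comp_unique:
  assumes "B \<in> m_space" "Z - B \<in> h_alg"
  shows "m_comp Z = B"
  unfolding m_comp_def
proof (rule the_equality)
  fix B' assume B': "B' \<in> m_space \<and> Z - B' \<in> h_alg"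
  have "B' - B \<in> m_space" using B' assms subspace_diff[OF subspace_m_space] by blast
  moreover have "B' - B \<in> h_alg"
    using subspace_diff[OF subspace_h_alg, of "Z - B" "Z - B'"] B' assms by simp
  ultimately have "B' - B \<in> {0}" using h_alg_inter_m_space by blast
  then show "B' = B" by simp
qed (use assms in simp)

lemma h_comp_m_space: "Z \<in> m_space \<Longrightarrow> h_comp Z = 0"
  by (rule h_comp_unique) (auto intro: subspace_0 subspace_h_alg)

lemma m_comp_m_space: "Z \<in> m_space \<Longrightarrow> m_comp Z = Z"
  by (rule m_comp_unique) (auto intro: subspace_0 subspace_h_alg)

lemma h_comp_h_alg: "Z \<in> h_alg \<Longrightarrow> h_comp Z = Z"
  by (rule h_comp_unique) (auto intro: subspace_0 subspace_m_space)

text \<open>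
  Outside \<^const>\<open>g_alg\<close> the descriptions in \<^const>\<open>h_comp\<close> and \<^const>\<open>m_comp\<close> are junk;
  these projections extend them linearly to all matrices, so that they can be differentiated.
\<close>

definition h_proj :: "'n::finite stmat \<Rightarrow> 'n stmat" where
  "h_proj Z = block 0 0 (\<chi> k l. (Z $ Some k $ Some l - Z $ Some l $ Some k) / 2)"

definition m_proj :: "'n::finite stmat \<Rightarrow> 'n stmat" where
  "m_proj Z = block (Z $ None $ None) (\<chi> l. Z $ None $ Some l)
    (\<chi> k l. (Z $ Some k $ Some l + Z $ Some l $ Some k) / 2)"

lemma linear_h_proj: "linear h_proj"
  by (rule linearI) (auto simp: stmat_eq_iff h_proj_def field_simps)

lemma linear_m_proj: "linear m_proj"
  by (rule linearI) (auto simp: stmat_eq_iff m_proj_def field_simps)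

lemma h_comp_eq_h_proj:
  assumes "Z \<in> g_alg"
  shows "h_comp Z = h_proj Z"
proof -
  obtain p q S where Z: "Z = block p q S" using assms by (auto simp: g_alg_def)
  show ?thesis
    unfolding Z
    by (rule h_comp_unique)
      (simp_all add: h_proj_def block_linear transpose_def vec_eq_iff field_simps)
qed

lemma m_comp_eq_m_proj:
  assumes "Z \<in> g_alg"
  shows "m_comp Z = m_proj Z"
proof -
  obtain p q S where Z: "Z = block p q S" using assms by (auto simp: g_alg_def)
  show ?thesis
    unfolding Z
    by (rule m_comp_unique)
      (simp_all add: m_proj_def block_linear transpose_def vec_eq_iff field_simps)
qed

section \<open>Curvature and torsion at the base point\<close>

lemma mat_1_in_g_alg: "mat 1 \<in> g_alg"
  by (simp add: g_alg_iff mat_def)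

lemma g_alg_mult: "A \<in> g_alg \<Longrightarrow> B \<in> g_alg \<Longrightarrow> A ** B \<in> g_alg"
  by (auto simp: g_alg_def block_mult)

lemma lie_in_g_alg: "A \<in> g_alg \<Longrightarrow> B \<in> g_alg \<Longrightarrow> lie A B \<in> g_alg"
  by (simp add: lie_def g_alg_mult subspace_diff[OF subspace_g_alg])

text \<open>This keeps the Maurer-Cartan form inside \<open>g_alg\<close>, where the components are
  meaningful. The first column of A has only its corner entry, so the first column of the inverse
  times that corner is the first unit vector.\<close>

lemma matrix_inv_in_g_alg:
  assumes "A \<in> g_alg" "invertible A"
  shows "matrix_inv A \<in> g_alg"
proof -
  let ?B = "matrix_inv A"
  have A: "A $ Some k $ None = 0" for k using assms(1) by (simp add: g_alg_iff)
  have col: "(?B ** A) $ i $ None = ?B $ i $ None * A $ None $ None" for i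
    by (simp add: matrix_matrix_mult_def sum_UNIV_option A)
  have "?B $ i $ None * A $ None $ None = (mat 1 :: 'a stmat) $ i $ None" for i
    using col[of i] invertible_matrix_inv(2)[OF assms(2)] by simp
  note * = this
  \<comment> \<open>The equation for the time row reads product = 1, so the corner is nonzero and
    can be cancelled in the other rows.\<close>
  have "A $ None $ None \<noteq> 0" using *[of None] by (auto simp: mat_def)
  then show ?thesis using *[of "Some _"]
    by (simp add: g_alg_iff mat_def)
qed

text \<open>Composing the derivative -V of the inverse with the bounded linear map sending A to P (A
  W) gives the value. F stands for \<open>h_comp\<close> or \<open>m_comp\<close>, which equals a
  linear map P only on \<open>g_alg\<close>; the curve stays there for small t, which suffices for
  the derivative.\<close>

lemma has_vector_derivative_maurer_cartan:
  assumes P: "linear P" and F: "\<And>Z. Z \<in> g_alg \<Longrightarrow> F Z = P Z"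
    and V: "V \<in> g_alg" and W: "W \<in> g_alg"
  shows "((\<lambda>t. F (maurer_cartan (mat 1 + t *\<^sub>R V) W)) has_vector_derivative - P (V ** W)) (at 0)"
proof -
  have "bounded_linear (\<lambda>A. P (A ** W))"
    using bounded_linear_compose[OF linear_conv_bounded_linear[THEN iffD1, OF P]
        bounded_bilinear.bounded_linear_left[OF bounded_bilinear_matrix_mult, of W]] .
  from bounded_linear.has_vector_derivative[OF this matrix_inv_has_vector_derivative[of V]]
  have D: "((\<lambda>t. P (maurer_cartan (mat 1 + t *\<^sub>R V) W)) has_vector_derivative - P (V ** W)) (at 0)"
    by (simp add: maurer_cartan_def matrix_mult_bilinear linear_neg[OF P])
  have ev: "eventually (\<lambda>t. t \<in> UNIV \<longrightarrow> P (maurer_cartan (mat 1 + t *\<^sub>R V) W)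
      = F (maurer_cartan (mat 1 + t *\<^sub>R V) W)) (nhds 0)"
    using eventually_invertible_mat_1_add[of V]
  proof eventually_elim
    case (elim t)
    have "mat 1 + t *\<^sub>R V \<in> g_alg"
      by (intro subspace_add subspace_scale subspace_g_alg mat_1_in_g_alg V)
    then have "maurer_cartan (mat 1 + t *\<^sub>R V) W \<in> g_alg"
      unfolding maurer_cartan_def using elim by (intro g_alg_mult matrix_inv_in_g_alg W)
    then show ?case by (simp add: F)
  qed
  show ?thesis
    using D has_vector_derivative_cong_ev[OF ev] ev by (auto simp: eventually_nhds)
qed

text \<open>The two directional derivatives are -P (V W) and -P (W V); their difference is -P of the
  bracket, and the bracket lies in \<open>g_alg\<close>, where P and F agree.\<close>

lemma ext_deriv_maurer_cartan:
  assumes "linear P" "\<And>Z. Z \<in> g_alg \<Longrightarrow> F Z = P Z" "V \<in> g_alg" "W \<in> g_alg"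
  shows "ext_deriv (\<lambda>g V. F (maurer_cartan g V)) (mat 1) V W = - F (lie V W)"
  using has_vector_derivative_maurer_cartan[of P F V W]
    has_vector_derivative_maurer_cartan[of P F W V] assms lie_in_g_alg[of V W]
  by (simp add: ext_deriv_def vector_derivative_at lie_def linear_diff)

lemma maurer_cartan_mat_1 [simp]: "maurer_cartan (mat 1) V = V"
  by (simp add: maurer_cartan_def matrix_inv_mat_1)

lemma lie_zero_left [simp]: "lie 0 A = 0"
  for A :: "real^'n^'n"
  by (simp add: lie_def matrix_mult_bilinear)

lemma curv0_eq:
  assumes "X \<in> m_space" "Y \<in> m_space"
  shows "curv0 X Y = - h_comp (lie X Y)"
proof -
  have "ext_deriv conn_form (mat 1) X Y = - h_comp (lie X Y)"
    unfolding conn_form_def[abs_def]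
    by (rule ext_deriv_maurer_cartan[OF linear_h_proj h_comp_eq_h_proj])
      (use assms m_space_subset_g_alg in auto)
  then show ?thesis
    by (simp add: curvature_form_def conn_form_def h_comp_m_space assms)
qed

lemma tors0_eq:
  assumes "X \<in> m_space" "Y \<in> m_space"
  shows "tors0 X Y = - m_comp (lie X Y)"
proof -
  have "ext_deriv solder_form (mat 1) X Y = - m_comp (lie X Y)"
    unfolding solder_form_def[abs_def]
    by (rule ext_deriv_maurer_cartan[OF linear_m_proj m_comp_eq_m_proj])
      (use assms m_space_subset_g_alg in auto)
  then show ?thesis
    by (simp add: torsion_form_def conn_form_def h_comp_m_space assms)
qed

section \<open>Boost and anisotropy generators\<close>

lemma boost_in_m_space [simp]: "boost c v \<in> m_space"
  by (simp add: boost_def transpose_linear)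

lemma aniso_in_m_space [simp]: "transpose C = C \<Longrightarrow> aniso c C \<in> m_space"
  by (simp add: aniso_def transpose_linear)

lemma boost_eq_0_iff: "c \<noteq> 0 \<Longrightarrow> boost c v = 0 \<longleftrightarrow> v = 0"
  by (simp add: boost_def block_zero)

lemma lie_boost_boost: "lie (boost c v1) (boost c v2) = 0"
  by (simp add: boost_def lie_block block_zero)

text \<open>Of the two products only the boost row times the spatial block survives; symmetry of C
  turns the row product into C v.\<close>

lemma lie_boost_aniso:
  assumes "transpose C = C"
  shows "lie (boost c v) (aniso c C) = boost c (- (1 / (2 * c^2)) *\<^sub>R (C *v v))"
proof -
  have "v v* C = C *v v" using assms by (metis transpose_matrix_vector)
  moreover have "((1 / c\<^sup>2) *\<^sub>R v) v* (- (1 / (2 * c\<^sup>2)) *\<^sub>R C)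
      = (1 / c^2) *\<^sub>R (- (1 / (2 * c^2)) *\<^sub>R (v v* C))"
    by (simp add: vec_eq_iff vector_matrix_mult_def sum_distrib_left sum_negf
        sum_divide_distrib mult_ac)
  ultimately show ?thesis
    by (simp add: boost_def aniso_def lie_block)
qed

lemma lie_aniso_aniso:
  "lie (aniso c C1) (aniso c C2) = block 0 0 ((1 / (4 * c^4)) *\<^sub>R lie C1 C2)"
  unfolding aniso_def lie_block lie_scaleR by (simp flip: power_add)

lemma lie_symmetric_in_h_alg:
  assumes "transpose C1 = C1" "transpose C2 = C2"
  shows "block 0 0 (r *\<^sub>R lie C1 C2) \<in> h_alg"
proof -
  have "transpose (lie C1 C2) = - lie C1 C2"
    using assms lie_anticommute by (metis transpose_lie)
  then show ?thesis by (simp add: transpose_linear)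
qed

text \<open>The plane lies in \<open>m_space\<close>, so its curvature is minus the rotational part
  of a multiple of \<open>lie A B\<close>, which has none.\<close>

lemma curv0_span_eq_0:
  assumes "A \<in> m_space" "B \<in> m_space" "lie A B \<in> m_space" "X \<in> span {A, B}" "Y \<in> span {A, B}"
  shows "curv0 X Y = 0"
proof -
  have "span {A, B} \<subseteq> m_space"
    using assms by (intro span_minimal subspace_m_space) auto
  moreover obtain k where "lie X Y = k *\<^sub>R lie A B"
    using lie_span_pair assms by blast
  ultimately show ?thesis
    using assms curv0_eq[of X Y] h_comp_m_space subspace_scale[OF subspace_m_space]
    by (auto simp: subset_iff)
qed

lemma curv0_aniso_aniso:
  assumes "transpose C1 = C1" "transpose C2 = C2"
  shows "curv0 (aniso c C1) (aniso c C2) = - block 0 0 ((1 / (4 * c^4)) *\<^sub>R lie C1 C2)"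
  using assms lie_symmetric_in_h_alg[OF assms]
  by (simp add: curv0_eq lie_aniso_aniso h_comp_h_alg)

lemma curv0_aniso_aniso_nonzero:
  assumes "c \<noteq> 0" "transpose C1 = C1" "transpose C2 = C2"
  shows "curv0 (aniso c C1) (aniso c C2) \<noteq> 0 \<longleftrightarrow> C1 ** C2 \<noteq> C2 ** C1"
  using assms by (simp add: curv0_aniso_aniso) (simp add: block_zero lie_def)

section \<open>Non-commuting example: normal stretch and 45-degree shear\<close>

lemma transpose_normal_stretch: "transpose (normal_stretch r) = normal_stretch r"
  by (auto simp: normal_stretch_def transpose_def vec_eq_iff)

lemma transpose_shear45: "transpose (shear45 i j s) = shear45 i j s"
  by (auto simp: shear45_def transpose_def vec_eq_iff)

lemma normal_stretch_mult_nth: "(normal_stretch r ** A) $ i $ j = r $ i * A $ i $ j"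
  by (simp add: matrix_matrix_mult_def normal_stretch_def if_distrib[of "\<lambda>x. x * _"] cong: if_cong)

lemma mult_normal_stretch_nth: "(A ** normal_stretch r) $ i $ j = r $ j * A $ i $ j"
  by (simp add: matrix_matrix_mult_def normal_stretch_def if_distrib[of "\<lambda>x. _ * x"] mult.commute
      cong: if_cong)

text \<open>A diagonal factor scales rows from the left and columns from the right, so equality at
  entry (i, j) would give r_i s = r_j s.\<close>

lemma normal_stretch_shear45_noncommuting:
  assumes "r $ i \<noteq> r $ j" "s \<noteq> 0"
  shows "normal_stretch r ** shear45 i j s \<noteq> shear45 i j s ** normal_stretch r"
proof
  assume "normal_stretch r ** shear45 i j s = shear45 i j s ** normal_stretch r"
  then have "r $ i * shear45 i j s $ i $ j = r $ j * shear45 i j s $ i $ j"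
    by (metis normal_stretch_mult_nth mult_normal_stretch_nth)
  then show False using assms by (simp add: shear45_def)
qed

section \<open>Torsion on mixed planes\<close>

lemma tors0_boost_aniso:
  assumes "transpose C = C"
  shows "tors0 (boost c v) (aniso c C) = - boost c (- (1 / (2 * c^2)) *\<^sub>R (C *v v))"
  using assms by (simp add: tors0_eq lie_boost_aniso m_comp_m_space)

lemma tors0_boost_aniso_nonzero:
  assumes "c \<noteq> 0" "transpose C = C"
  shows "tors0 (boost c v) (aniso c C) \<noteq> 0 \<longleftrightarrow> C *v v \<noteq> 0"
  using assms by (simp add: tors0_boost_aniso boost_eq_0_iff)

theorem theorem29:
  fixes c :: real
  assumes "c > 0"
    and "CARD('n::finite) = 2 \<or> CARD('n) = 3"
  shows
    "\<comment> \<open>the decomposition is a direct sum and reductive\<close>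
     subspace (g_alg :: 'n stmat set)
   \<and> subspace (h_alg :: 'n stmat set)
   \<and> subspace (m_space :: 'n stmat set)
   \<and> (g_alg :: 'n stmat set) = {A + B | A B. A \<in> h_alg \<and> B \<in> m_space}
   \<and> (h_alg :: 'n stmat set) \<inter> m_space = {0}
   \<and> span {lie A B | A B. A \<in> h_alg \<and> B \<in> m_space} \<subseteq> (m_space :: 'n stmat set)
     \<comment> \<open>generators and brackets\<close>
   \<and> (\<forall>v :: real^'n. boost c v \<in> m_space)
   \<and> (\<forall>C :: 'n smat. transpose C = C \<longrightarrow> aniso c C \<in> m_space)
   \<and> (\<forall>v1 v2 :: real^'n. lie (boost c v1) (boost c v2) = 0)
   \<and> (\<forall>(v :: real^'n) C. transpose C = C \<longrightarrow>
        lie (boost c v) (aniso c C) = boost c (- (1 / (2 * c^2)) *\<^sub>R (C *v v))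
      \<and> boost c (- (1 / (2 * c^2)) *\<^sub>R (C *v v)) \<in> m_space)
   \<and> (\<forall>C1 C2 :: 'n smat. transpose C1 = C1 \<and> transpose C2 = C2 \<longrightarrow>
        lie (aniso c C1) (aniso c C2) = block 0 0 ((1 / (4 * c^4)) *\<^sub>R lie C1 C2)
      \<and> block 0 0 ((1 / (4 * c^4)) *\<^sub>R lie C1 C2) \<in> h_alg)
     \<comment> \<open>curvature and torsion of the canonical connection at the base point\<close>
   \<and> (\<forall>X \<in> (m_space :: 'n stmat set). \<forall>Y \<in> m_space.
        curv0 X Y = - h_comp (lie X Y) \<and> tors0 X Y = - m_comp (lie X Y))
     \<comment> \<open>curvature on boost-boost and boost-anisotropy planes\<close>
   \<and> (\<forall>v1 v2 :: real^'n. \<forall>X \<in> span {boost c v1, boost c v2}. \<forall>Y \<in> span {boost c v1, boost c v2}.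
        curv0 X Y = 0)
   \<and> (\<forall>(v :: real^'n) C. transpose C = C \<longrightarrow>
        (\<forall>X \<in> span {boost c v, aniso c C}. \<forall>Y \<in> span {boost c v, aniso c C}. curv0 X Y = 0))
     \<comment> \<open>curvature on anisotropy-anisotropy planes, for both orientations\<close>
   \<and> (\<forall>C1 C2 :: 'n smat. transpose C1 = C1 \<and> transpose C2 = C2 \<longrightarrow>
        curv0 (aniso c C1) (aniso c C2) = - block 0 0 ((1 / (4 * c^4)) *\<^sub>R lie C1 C2)
      \<and> curv0 (aniso c C2) (aniso c C1) = block 0 0 ((1 / (4 * c^4)) *\<^sub>R lie C1 C2)
      \<and> (curv0 (aniso c C1) (aniso c C2) \<noteq> 0 \<longleftrightarrow> C1 ** C2 \<noteq> C2 ** C1))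
   \<and> (\<forall>(i :: 'n) j r s. i \<noteq> j \<and> r $ i \<noteq> r $ j \<and> s \<noteq> 0 \<longrightarrow>
        transpose (normal_stretch r) = normal_stretch r
      \<and> transpose (shear45 i j s) = shear45 i j s
      \<and> curv0 (aniso c (normal_stretch r)) (aniso c (shear45 i j s)) \<noteq> 0)
     \<comment> \<open>torsion on boost-anisotropy planes\<close>
   \<and> (\<forall>(v :: real^'n) C. transpose C = C \<longrightarrow>
        tors0 (boost c v) (aniso c C) = - boost c (- (1 / (2 * c^2)) *\<^sub>R (C *v v))
      \<and> (tors0 (boost c v) (aniso c C) \<noteq> 0 \<longleftrightarrow> C *v v \<noteq> 0))
   \<and> (\<exists>(v :: real^'n) C. transpose C = C \<and> tors0 (boost c v) (aniso c C) \<noteq> 0)"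
proof (intro conjI)
  have c: "c \<noteq> 0" using assms(1) by simp
  show "subspace (g_alg :: 'n stmat set)" "subspace (h_alg :: 'n stmat set)"
    "subspace (m_space :: 'n stmat set)"
    by (rule subspace_g_alg subspace_h_alg subspace_m_space)+
  show "(g_alg :: 'n stmat set) = {A + B | A B. A \<in> h_alg \<and> B \<in> m_space}"
    by (rule g_alg_eq_sum)
  show "(h_alg :: 'n stmat set) \<inter> m_space = {0}"
    by (rule h_alg_inter_m_space)
  show "span {lie A B | A B. A \<in> h_alg \<and> B \<in> m_space} \<subseteq> (m_space :: 'n stmat set)"
    by (rule span_minimal) (auto intro: lie_h_alg_m_space subspace_m_space)
  show "\<forall>v1 v2 :: real^'n. \<forall>X \<in> span {boost c v1, boost c v2}. \<forall>Y \<in> span {boost c v1, boost c v2}.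
      curv0 X Y = 0"
    by (intro allI ballI, rule curv0_span_eq_0)
      (simp_all add: lie_boost_boost subspace_0 subspace_m_space)
  show "\<forall>(v :: real^'n) C. transpose C = C \<longrightarrow>
      (\<forall>X \<in> span {boost c v, aniso c C}. \<forall>Y \<in> span {boost c v, aniso c C}. curv0 X Y = 0)"
    by (intro allI impI ballI, rule curv0_span_eq_0) (simp_all add: lie_boost_aniso)
  show "\<forall>C1 C2 :: 'n smat. transpose C1 = C1 \<and> transpose C2 = C2 \<longrightarrow>
        curv0 (aniso c C1) (aniso c C2) = - block 0 0 ((1 / (4 * c^4)) *\<^sub>R lie C1 C2)
      \<and> curv0 (aniso c C2) (aniso c C1) = block 0 0 ((1 / (4 * c^4)) *\<^sub>R lie C1 C2)
      \<and> (curv0 (aniso c C1) (aniso c C2) \<noteq> 0 \<longleftrightarrow> C1 ** C2 \<noteq> C2 ** C1)"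
  proof (intro allI impI)
    fix C1 C2 :: "'n smat"
    assume C: "transpose C1 = C1 \<and> transpose C2 = C2"
    have "curv0 (aniso c C2) (aniso c C1) = block 0 0 ((1 / (4 * c^4)) *\<^sub>R lie C1 C2)"
      using C by (subst lie_anticommute) (simp add: curv0_aniso_aniso block_uminus)
    then show "curv0 (aniso c C1) (aniso c C2) = - block 0 0 ((1 / (4 * c^4)) *\<^sub>R lie C1 C2)
      \<and> curv0 (aniso c C2) (aniso c C1) = block 0 0 ((1 / (4 * c^4)) *\<^sub>R lie C1 C2)
      \<and> (curv0 (aniso c C1) (aniso c C2) \<noteq> 0 \<longleftrightarrow> C1 ** C2 \<noteq> C2 ** C1)"
      using C c curv0_aniso_aniso curv0_aniso_aniso_nonzero by blast
  qed
  show "\<forall>(i :: 'n) j r s. i \<noteq> j \<and> r $ i \<noteq> r $ j \<and> s \<noteq> 0 \<longrightarrow>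
        transpose (normal_stretch r) = normal_stretch r
      \<and> transpose (shear45 i j s) = shear45 i j s
      \<and> curv0 (aniso c (normal_stretch r)) (aniso c (shear45 i j s)) \<noteq> 0"
    by (simp add: transpose_normal_stretch transpose_shear45 curv0_aniso_aniso_nonzero c
        normal_stretch_shear45_noncommuting)
  show "\<exists>(v :: real^'n) C. transpose C = C \<and> tors0 (boost c v) (aniso c C) \<noteq> 0"
    \<comment> \<open>The witnesses are the all-ones velocity and the identity tensor, for which C v
      = v is nonzero: an isotropic change of sound speed already gives torsion.\<close>
    by (intro exI[of _ "1 :: real^'n"] exI[of _ "mat 1 :: 'n smat"])
      (simp add: tors0_boost_aniso_nonzero c)
  show "\<forall>(v :: real^'n) C. transpose C = C \<longrightarrow>
        tors0 (boost c v) (aniso c C) = - boost c (- (1 / (2 * c^2)) *\<^sub>R (C *v v))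
      \<and> (tors0 (boost c v) (aniso c C) \<noteq> 0 \<longleftrightarrow> C *v v \<noteq> 0)"
    using tors0_boost_aniso tors0_boost_aniso_nonzero c by blast
  show "\<forall>(v :: real^'n) C. transpose C = C \<longrightarrow>
        lie (boost c v) (aniso c C) = boost c (- (1 / (2 * c^2)) *\<^sub>R (C *v v))
      \<and> boost c (- (1 / (2 * c^2)) *\<^sub>R (C *v v)) \<in> m_space"
    using lie_boost_aniso boost_in_m_space by blast
qed (use aniso_in_m_space lie_boost_boost lie_aniso_aniso lie_symmetric_in_h_alg curv0_eq
    tors0_eq in auto)

end
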